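(* Let $\mathcal{T}=\mathrm{Trian}(A,M,B)$ be a triangular algebra and $(d_1,d_2,d_3)$ a triple of $R$-linear maps on $\mathcal{T}$. Then $(d_1,d_2,d_3)$ is a ternary derivation of $\mathcal{T}$ if and only if it is of the following form: $$d_1\begin{pmatrix}a&m\\&b\end{pmatrix}=\begin{pmatrix}\delta_1(a)&an_1+\tau_1(m)+n_1'b\\&\mu_1(b)\end{pmatrix},$$ $$d_2\begin{pmatrix}a&m\\&b\end{pmatrix}=\begin{pmatrix}\delta_2(a)&an_2+\tau_2(m)+n_1'b\\&\mu_2(b)\end{pmatrix},$$ $$d_3\begin{pmatrix}a&m\\&b\end{pmatrix}=\begin{pmatrix}\delta_3(a)&an_1+\tau_3(m)-n_2b\\&\mu_3(b)\end{pmatrix},$$ where $n_1,n_1',n_2\in M$ and $\delta_i:A\to A$, $\tau_i:M\to M$, $\mu_i:B\to B$ ($i=1,2,3$) are linear maps such that (i) $(\delta_1,\delta_2,\delta_3)$ is a ternary derivation of $A$; (ii) $(\mu_1,\mu_2,\mu_3)$ is a ternary derivation of $B$; (iii) $\tau_1(am)=\delta_2(a)m+a\tau_3(m)$ for all $a\in A$ and $m\in M$; (iv) $\tau_1(mb)=m\mu_3(b)+\tau_2(m)b$ for all $b\in B$ and $m\in M$.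
   Context: All algebras are unital and associative over a fixed commutative unital ring $R$. For algebras $A$, $B$ and a nonzero $(A,B)$-bimodule $M$, the triangular algebra $\mathrm{Trian}(A,M,B)$ is the algebra of matrices $\begin{pmatrix}a&m\\&b\end{pmatrix}$ with $a\in A$, $m\in M$, $b\in B$ under the usual matrix operations. A triple of $R$-linear maps $(d_1,d_2,d_3)$ of an algebra $\mathcal{A}$ into itself is a ternary derivation of $\mathcal{A}$ if $d_1(xy)=d_2(x)y+xd_3(y)$ for all $x,y\in\mathcal{A}$. *)

theory Defs
  imports Complex_Main
begin

text \<open>The multiplication and the unit are explicit parameters, because the multiplication of a
  triangular algebra depends on the two module actions and so cannot come from a type class.\<close>

locale unital_algebra = module scale
  for scale :: "'r::comm_ring_1 \<Rightarrow> 'x::ab_group_add \<Rightarrow> 'x" +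
  fixes mult :: "'x \<Rightarrow> 'x \<Rightarrow> 'x" and unit :: 'x
  assumes mult_assoc: "mult (mult x y) z = mult x (mult y z)"
    and mult_add_left: "mult (x + y) z = mult x z + mult y z"
    and mult_add_right: "mult x (y + z) = mult x y + mult x z"
    and mult_scale_left: "mult (scale r x) y = scale r (mult x y)"
    and mult_scale_right: "mult x (scale r y) = scale r (mult x y)"
    and mult_unit_left: "mult unit x = x"
    and mult_unit_right: "mult x unit = x"

definition ternary_derivation ::
  "('r::comm_ring_1 \<Rightarrow> 'x::ab_group_add \<Rightarrow> 'x) \<Rightarrow> ('x \<Rightarrow> 'x \<Rightarrow> 'x) \<Rightarrow>
    ('x \<Rightarrow> 'x) \<Rightarrow> ('x \<Rightarrow> 'x) \<Rightarrow> ('x \<Rightarrow> 'x) \<Rightarrow> bool" where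
  "ternary_derivation scale mult d1 d2 d3 \<longleftrightarrow>
    module_hom scale scale d1 \<and> module_hom scale scale d2 \<and> module_hom scale scale d3 \<and>
    (\<forall>x y. d1 (mult x y) = mult (d2 x) y + mult x (d3 y))"

text \<open>Bimodules over \<open>R\<close>-algebras: the two actions induce the same \<open>R\<close>-module structure
  \<open>scaleM\<close>. The class \<^class>\<open>ring_1\<close> excludes the zero ring; this loses nothing when \<open>M\<close> is
  nonzero, as unital actions of a zero ring force \<open>M = 0\<close>.\<close>

locale algebra_bimodule =
  A: unital_algebra scaleA "(*)" 1 +
  B: unital_algebra scaleB "(*)" 1 +
  M: module scaleM
  for scaleA :: "'r::comm_ring_1 \<Rightarrow> 'a::ring_1 \<Rightarrow> 'a"
    and scaleB :: "'r \<Rightarrow> 'b::ring_1 \<Rightarrow> 'b"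
    and scaleM :: "'r \<Rightarrow> 'm::ab_group_add \<Rightarrow> 'm" +
  fixes lact :: "'a \<Rightarrow> 'm \<Rightarrow> 'm" (infixr "\<rhd>" 75)
    and ract :: "'m \<Rightarrow> 'b \<Rightarrow> 'm" (infixl "\<lhd>" 75)
  assumes lact_add_left: "(a + a') \<rhd> m = (a \<rhd> m) + (a' \<rhd> m)"
    and lact_add_right: "a \<rhd> (m + m') = (a \<rhd> m) + (a \<rhd> m')"
    and lact_mult: "(a * a') \<rhd> m = a \<rhd> (a' \<rhd> m)"
    and lact_one: "1 \<rhd> m = m"
    and ract_add_left: "(m + m') \<lhd> b = (m \<lhd> b) + (m' \<lhd> b)"
    and ract_add_right: "m \<lhd> (b + b') = (m \<lhd> b) + (m \<lhd> b')"
    and ract_mult: "m \<lhd> (b * b') = (m \<lhd> b) \<lhd> b'"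
    and ract_one: "m \<lhd> 1 = m"
    and lact_ract: "(a \<rhd> m) \<lhd> b = a \<rhd> (m \<lhd> b)"
    and lact_scale_left: "(scaleA r a) \<rhd> m = scaleM r (a \<rhd> m)"
    and lact_scale_right: "a \<rhd> (scaleM r m) = scaleM r (a \<rhd> m)"
    and ract_scale_left: "(scaleM r m) \<lhd> b = scaleM r (m \<lhd> b)"
    and ract_scale_right: "m \<lhd> (scaleB r b) = scaleM r (m \<lhd> b)"

text \<open>\<open>Trian a m b\<close> is the upper triangular matrix with first row \<open>a, m\<close> and second row
  \<open>0, b\<close>.\<close>

datatype ('a, 'm, 'b) trian = Trian (tri11: 'a) (tri12: 'm) (tri22: 'b)

instantiation trian :: (ab_group_add, ab_group_add, ab_group_add) ab_group_add
begin

definition zero_trian :: "('a, 'b, 'c) trian" where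
  "0 = Trian 0 0 0"

definition plus_trian :: "('a, 'b, 'c) trian \<Rightarrow> ('a, 'b, 'c) trian \<Rightarrow> ('a, 'b, 'c) trian" where
  "x + y = Trian (tri11 x + tri11 y) (tri12 x + tri12 y) (tri22 x + tri22 y)"

definition minus_trian :: "('a, 'b, 'c) trian \<Rightarrow> ('a, 'b, 'c) trian \<Rightarrow> ('a, 'b, 'c) trian" where
  "x - y = Trian (tri11 x - tri11 y) (tri12 x - tri12 y) (tri22 x - tri22 y)"

definition uminus_trian :: "('a, 'b, 'c) trian \<Rightarrow> ('a, 'b, 'c) trian" where
  "- x = Trian (- tri11 x) (- tri12 x) (- tri22 x)"

instance
  by standard (simp_all add: zero_trian_def plus_trian_def minus_trian_def uminus_trian_def
      trian.expand algebra_simps)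

end

definition trian_scale ::
  "('r \<Rightarrow> 'a \<Rightarrow> 'a) \<Rightarrow> ('r \<Rightarrow> 'm \<Rightarrow> 'm) \<Rightarrow> ('r \<Rightarrow> 'b \<Rightarrow> 'b) \<Rightarrow>
    'r \<Rightarrow> ('a, 'm, 'b) trian \<Rightarrow> ('a, 'm, 'b) trian" where
  "trian_scale scaleA scaleM scaleB r x =
    Trian (scaleA r (tri11 x)) (scaleM r (tri12 x)) (scaleB r (tri22 x))"

definition trian_mult ::
  "('a::ring_1 \<Rightarrow> 'm::ab_group_add \<Rightarrow> 'm) \<Rightarrow> ('m \<Rightarrow> 'b::ring_1 \<Rightarrow> 'm) \<Rightarrow>
    ('a, 'm, 'b) trian \<Rightarrow> ('a, 'm, 'b) trian \<Rightarrow> ('a, 'm, 'b) trian" where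
  "trian_mult lact ract x y =
    Trian (tri11 x * tri11 y) (lact (tri11 x) (tri12 y) + ract (tri12 x) (tri22 y))
      (tri22 x * tri22 y)"

lemma (in algebra_bimodule) trian_unital_algebra:
  "unital_algebra (trian_scale scaleA scaleM scaleB) (trian_mult lact ract) (Trian 1 0 1)"
proof -
  have z: "a \<rhd> 0 = 0" "0 \<lhd> b = 0" for a b
    using lact_add_right[of a 0 0] ract_add_left[of 0 0 b] by simp_all
  show ?thesis
    by unfold_locales (simp_all add: trian_scale_def trian_mult_def plus_trian_def z
        A.scale_right_distrib A.scale_left_distrib B.scale_right_distrib B.scale_left_distrib
        M.scale_right_distrib M.scale_left_distrib A.mult_scale_left A.mult_scale_right
        B.mult_scale_left B.mult_scale_right lact_add_left lact_add_right lact_mult lact_one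
        ract_add_left ract_add_right ract_mult ract_one lact_ract lact_scale_left
        lact_scale_right ract_scale_left ract_scale_right mult.assoc distrib_left distrib_right)
qed

end

theory Submission
  imports Defs
begin

text \<open>The proof is a Peirce decomposition. A matrix is the sum of its three corners
  \<open>Trian a 0 0\<close>, \<open>Trian 0 m 0\<close> and \<open>Trian 0 0 b\<close>, and both sides of the product rule
  \<open>d1 (x y) = d2 x y + x d3 y\<close> are biadditive, so the rule holds iff it holds when \<open>x\<close> and
  \<open>y\<close> each lie in one corner.

  Many products of corners vanish, and the units \<open>1\<close> of \<open>A\<close> and \<open>B\<close> give the corner
  idempotents. Whenever such an idempotent annihilates one of the two factors, or multiplies it
  trivially, the rule becomes a linear equation on single entries. These equations leave no room
  on the diagonal: each \<open>di\<close> sends the \<open>A\<close>-corner into the first row, the \<open>B\<close>-corner into the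
  second column and the \<open>M\<close>-corner into itself (\<open>ternary_derivation_trian_diagonal\<close>). Off the
  diagonal they say that the upper right entries produced by the \<open>A\<close>- and \<open>B\<close>-corners are
  multiples of their values at \<open>1\<close>; the orthogonality of the \<open>A\<close>- and \<open>B\<close>-corners is what links
  \<open>d2\<close> on the first to \<open>d3\<close> on the second and forces the shared element \<open>n2\<close> with opposite signs
  (\<open>ternary_derivation_trian_off_diagonal\<close>). What remains of the rule is its restriction to two
  factors in the \<open>A\<close>-corner or two in the \<open>B\<close>-corner, which makes the diagonal blocks ternary
  derivations, and to one factor in the \<open>M\<close>-corner and one in the \<open>A\<close>- or \<open>B\<close>-corner, which
  gives the two compatibility conditions on the maps of \<open>M\<close>. The converse is an
  expansion in which the \<open>n2\<close>-terms cancel because the two actions commute.\<close>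

section \<open>Corners of a triangular algebra\<close>

context algebra_bimodule
begin

abbreviation scaleT :: "'r \<Rightarrow> ('a, 'm, 'b) trian \<Rightarrow> ('a, 'm, 'b) trian" where
  "scaleT \<equiv> trian_scale scaleA scaleM scaleB"

abbreviation multT :: "('a, 'm, 'b) trian \<Rightarrow> ('a, 'm, 'b) trian \<Rightarrow> ('a, 'm, 'b) trian" where
  "multT \<equiv> trian_mult (\<rhd>) (\<lhd>)"

lemma act_zero [simp]: "a \<rhd> 0 = 0" "0 \<rhd> m = 0" "0 \<lhd> b = 0" "m \<lhd> 0 = 0"
  using lact_add_right[of a 0 0] lact_add_left[of 0 0 m]
    ract_add_left[of 0 0 b] ract_add_right[of m 0 0] by simp_all

lemma lact_diff_right: "a \<rhd> (m - m') = (a \<rhd> m) - (a \<rhd> m')"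
  using lact_add_right[of a "m - m'" m'] by (simp add: algebra_simps)

lemma module_trian: "module scaleT"
  using trian_unital_algebra by (rule unital_algebra.axioms(1))

lemma module_hom_corners:
  "module_hom scaleA scaleT (\<lambda>a. Trian a 0 0)"
  "module_hom scaleM scaleT (\<lambda>m. Trian 0 m 0)"
  "module_hom scaleB scaleT (\<lambda>b. Trian 0 0 b)"
  by (intro module_hom.intro module_trian A.module_axioms B.module_axioms M.module_axioms
      module_hom_axioms.intro; simp add: plus_trian_def trian_scale_def)+

lemma module_hom_entries:
  "module_hom scaleT scaleA tri11"
  "module_hom scaleT scaleM tri12"
  "module_hom scaleT scaleB tri22"
  by (intro module_hom.intro module_trian A.module_axioms B.module_axioms M.module_axioms
      module_hom_axioms.intro; simp add: plus_trian_def trian_scale_def)+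

lemma module_hom_diagonal_blocks:
  assumes "module_hom scaleT scaleT d"
  shows "module_hom scaleA scaleA (\<lambda>a. tri11 (d (Trian a 0 0)))"
    and "module_hom scaleM scaleM (\<lambda>m. tri12 (d (Trian 0 m 0)))"
    and "module_hom scaleB scaleB (\<lambda>b. tri22 (d (Trian 0 0 b)))"
  using module_hom_corners[THEN module_hom_compose, OF assms]
    module_hom_entries[THEN [2] module_hom_compose]
  by (force simp: comp_def)+

lemma additive_trian_corner_sum:
  fixes d :: "('a, 'm, 'b) trian \<Rightarrow> ('a, 'm, 'b) trian"
  assumes "module_hom scaleT scaleT d"
  shows "d (Trian a m b) = d (Trian a 0 0) + d (Trian 0 m 0) + d (Trian 0 0 b)"
proof -
  have "Trian a m b = Trian a 0 0 + Trian 0 m 0 + Trian 0 0 b"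
    by (simp add: plus_trian_def)
  then show ?thesis
    by (simp add: module_hom.add[OF assms])
qed

end

section \<open>Entries of a ternary derivation\<close>

locale trian_ternary_derivation = algebra_bimodule scaleA scaleB scaleM lact ract
  for scaleA :: "'r::comm_ring_1 \<Rightarrow> 'a::ring_1 \<Rightarrow> 'a"
    and scaleB :: "'r \<Rightarrow> 'b::ring_1 \<Rightarrow> 'b"
    and scaleM :: "'r \<Rightarrow> 'm::ab_group_add \<Rightarrow> 'm"
    and lact :: "'a \<Rightarrow> 'm \<Rightarrow> 'm" (infixr "\<rhd>" 75)
    and ract :: "'m \<Rightarrow> 'b \<Rightarrow> 'm" (infixl "\<lhd>" 75) +
  fixes d1 d2 d3 :: "('a, 'm, 'b) trian \<Rightarrow> ('a, 'm, 'b) trian"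
  assumes ternary: "ternary_derivation scaleT multT d1 d2 d3"
begin

lemma hom: "module_hom scaleT scaleT d1" "module_hom scaleT scaleT d2" "module_hom scaleT scaleT d3"
  using ternary by (simp_all add: ternary_derivation_def)

lemma entries_of_product_rule:
  "tri11 (d1 (multT x y)) = tri11 (d2 x) * tri11 y + tri11 x * tri11 (d3 y)"
  "tri12 (d1 (multT x y)) = (tri11 (d2 x) \<rhd> tri12 y) + (tri12 (d2 x) \<lhd> tri22 y)
     + (tri11 x \<rhd> tri12 (d3 y)) + (tri12 x \<lhd> tri22 (d3 y))"
  "tri22 (d1 (multT x y)) = tri22 (d2 x) * tri22 y + tri22 x * tri22 (d3 y)"
proof -
  have "d1 (multT x y) = multT (d2 x) y + multT x (d3 y)"
    using ternary by (simp add: ternary_derivation_def)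
  then show
    "tri11 (d1 (multT x y)) = tri11 (d2 x) * tri11 y + tri11 x * tri11 (d3 y)"
    "tri12 (d1 (multT x y)) = (tri11 (d2 x) \<rhd> tri12 y) + (tri12 (d2 x) \<lhd> tri22 y)
       + (tri11 x \<rhd> tri12 (d3 y)) + (tri12 x \<lhd> tri22 (d3 y))"
    "tri22 (d1 (multT x y)) = tri22 (d2 x) * tri22 y + tri22 x * tri22 (d3 y)"
    by (simp_all add: trian_mult_def plus_trian_def ac_simps)
qed

lemma d1_zero [simp]: "d1 (Trian 0 0 0) = Trian 0 0 0"
  using module_hom.zero[OF hom(1)] by (simp add: zero_trian_def)

text \<open>An entry of \<open>d2 x\<close> is isolated by a right factor \<open>y\<close> that is a corner idempotent, an entry
  of \<open>d3 y\<close> by a left factor \<open>x\<close> of that kind. For \<open>d2\<close> and \<open>d3\<close> on the two diagonal corners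
  and for \<open>d2\<close> at the upper left, \<open>d3\<close> at the lower right entry of the \<open>M\<close>-corner, the product of the
  factors is zero; every other entry is then read off from a product that reproduces the
  argument.\<close>
lemma ternary_derivation_trian_diagonal:
  "tri22 (d1 (Trian a 0 0)) = 0" "tri22 (d2 (Trian a 0 0)) = 0" "tri22 (d3 (Trian a 0 0)) = 0"
  "tri11 (d1 (Trian 0 0 b)) = 0" "tri11 (d2 (Trian 0 0 b)) = 0" "tri11 (d3 (Trian 0 0 b)) = 0"
  "tri11 (d1 (Trian 0 m 0)) = 0" "tri11 (d2 (Trian 0 m 0)) = 0" "tri11 (d3 (Trian 0 m 0)) = 0"
  "tri22 (d1 (Trian 0 m 0)) = 0" "tri22 (d2 (Trian 0 m 0)) = 0" "tri22 (d3 (Trian 0 m 0)) = 0"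
proof -
  note p11 = entries_of_product_rule(1)[unfolded trian_mult_def]
    and p22 = entries_of_product_rule(3)[unfolded trian_mult_def]
  show "tri22 (d2 (Trian a 0 0)) = 0"
    using p22[of "Trian a 0 0" "Trian 0 0 1"] by simp
  show "tri22 (d3 (Trian a 0 0)) = 0"
    using p22[of "Trian 0 0 1" "Trian a 0 0"] by simp
  show "tri22 (d1 (Trian a 0 0)) = 0"
    using p22[of "Trian a 0 0" "Trian 1 0 0"] by simp
  show "tri11 (d2 (Trian 0 0 b)) = 0"
    using p11[of "Trian 0 0 b" "Trian 1 0 0"] by simp
  show "tri11 (d3 (Trian 0 0 b)) = 0"
    using p11[of "Trian 1 0 0" "Trian 0 0 b"] by simp
  show "tri11 (d1 (Trian 0 0 b)) = 0"
    using p11[of "Trian 0 0 b" "Trian 0 0 1"] by simp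
  show "tri11 (d2 (Trian 0 m 0)) = 0"
    using p11[of "Trian 0 m 0" "Trian 1 0 0"] by simp
  show M1: "tri11 (d1 (Trian 0 m 0)) = 0"
    using p11[of "Trian 0 m 0" "Trian 0 0 1"] by (simp add: ract_one)
  show "tri11 (d3 (Trian 0 m 0)) = 0"
    using p11[of "Trian 1 0 0" "Trian 0 m 0"] M1 by (simp add: lact_one)
  show "tri22 (d3 (Trian 0 m 0)) = 0"
    using p22[of "Trian 0 0 1" "Trian 0 m 0"] by simp
  show N1: "tri22 (d1 (Trian 0 m 0)) = 0"
    using p22[of "Trian 1 0 0" "Trian 0 m 0"] by (simp add: lact_one)
  show "tri22 (d2 (Trian 0 m 0)) = 0"
    using p22[of "Trian 0 m 0" "Trian 0 0 1"] N1 by (simp add: ract_one)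
qed

text \<open>Multiplying by a corner idempotent from one side equates two of the maps, and from the other
  side turns the entry into a multiple of a value at \<open>1\<close>. The entries of \<open>d2\<close> at \<open>A\<close> and \<open>d3\<close>
  at \<open>B\<close> come from \<open>0 = d2 x y + x d3 y\<close> for the orthogonal factors \<open>x = Trian a 0 0\<close>,
  \<open>y = Trian 0 0 b\<close>: setting \<open>a = b = 1\<close> there shows that their values at \<open>1\<close> are
  opposite.\<close>
lemma ternary_derivation_trian_off_diagonal:
  defines "n1 \<equiv> tri12 (d3 (Trian 1 0 0))" and "n1' \<equiv> tri12 (d2 (Trian 0 0 1))"
    and "n2 \<equiv> tri12 (d2 (Trian 1 0 0))"
  shows "tri12 (d1 (Trian a 0 0)) = a \<rhd> n1" "tri12 (d3 (Trian a 0 0)) = a \<rhd> n1"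
    "tri12 (d1 (Trian 0 0 b)) = n1' \<lhd> b" "tri12 (d2 (Trian 0 0 b)) = n1' \<lhd> b"
    "tri12 (d2 (Trian a 0 0)) = a \<rhd> n2" "tri12 (d3 (Trian 0 0 b)) = - (n2 \<lhd> b)"
proof -
  note p12 = entries_of_product_rule(2)[unfolded trian_mult_def]
  show A1: "tri12 (d1 (Trian a 0 0)) = a \<rhd> n1"
    using p12[of "Trian a 0 0" "Trian 1 0 0"] by (simp add: n1_def)
  show "tri12 (d3 (Trian a 0 0)) = a \<rhd> n1"
    using p12[of "Trian 1 0 0" "Trian a 0 0"] A1 by (simp add: lact_one)
  show B1: "tri12 (d1 (Trian 0 0 b)) = n1' \<lhd> b"
    using p12[of "Trian 0 0 1" "Trian 0 0 b"] by (simp add: n1'_def)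
  show "tri12 (d2 (Trian 0 0 b)) = n1' \<lhd> b"
    using p12[of "Trian 0 0 b" "Trian 0 0 1"] B1 by (simp add: ract_one)
  have orthogonal: "(tri12 (d2 (Trian a 0 0)) \<lhd> b) + (a \<rhd> tri12 (d3 (Trian 0 0 b))) = 0" for a b
    using p12[of "Trian a 0 0" "Trian 0 0 b"] by simp
  show B3: "tri12 (d3 (Trian 0 0 b)) = - (n2 \<lhd> b)" for b
    using orthogonal[of 1 b] by (simp add: n2_def lact_one eq_neg_iff_add_eq_0 add.commute)
  show "tri12 (d2 (Trian a 0 0)) = a \<rhd> n2"
    using orthogonal[of a 1] lact_diff_right[of a 0 n2] B3[of 1]
    by (simp add: ract_one)
qed

lemma blocks_ternary_A:
  "ternary_derivation scaleA (*) (\<lambda>a. tri11 (d1 (Trian a 0 0)))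
     (\<lambda>a. tri11 (d2 (Trian a 0 0))) (\<lambda>a. tri11 (d3 (Trian a 0 0)))"
  using entries_of_product_rule(1)[of "Trian _ 0 0" "Trian _ 0 0"]
  by (simp add: ternary_derivation_def module_hom_diagonal_blocks hom trian_mult_def)

lemma blocks_ternary_B:
  "ternary_derivation scaleB (*) (\<lambda>b. tri22 (d1 (Trian 0 0 b)))
     (\<lambda>b. tri22 (d2 (Trian 0 0 b))) (\<lambda>b. tri22 (d3 (Trian 0 0 b)))"
  using entries_of_product_rule(3)[of "Trian 0 0 _" "Trian 0 0 _"]
  by (simp add: ternary_derivation_def module_hom_diagonal_blocks hom trian_mult_def)

lemma blocks_action:
  "tri12 (d1 (Trian 0 (a \<rhd> m) 0)) =
     (tri11 (d2 (Trian a 0 0)) \<rhd> m) + (a \<rhd> tri12 (d3 (Trian 0 m 0)))"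
  "tri12 (d1 (Trian 0 (m \<lhd> b) 0)) =
     (m \<lhd> tri22 (d3 (Trian 0 0 b))) + (tri12 (d2 (Trian 0 m 0)) \<lhd> b)"
  using entries_of_product_rule(2)[of "Trian a 0 0" "Trian 0 m 0"]
    entries_of_product_rule(2)[of "Trian 0 m 0" "Trian 0 0 b"]
  by (simp_all add: trian_mult_def add.commute)

lemma block_form:
  "d1 (Trian a m b) = Trian (tri11 (d1 (Trian a 0 0)))
     ((a \<rhd> tri12 (d3 (Trian 1 0 0))) + tri12 (d1 (Trian 0 m 0))
       + (tri12 (d2 (Trian 0 0 1)) \<lhd> b)) (tri22 (d1 (Trian 0 0 b)))"
  "d2 (Trian a m b) = Trian (tri11 (d2 (Trian a 0 0)))
     ((a \<rhd> tri12 (d2 (Trian 1 0 0))) + tri12 (d2 (Trian 0 m 0))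
       + (tri12 (d2 (Trian 0 0 1)) \<lhd> b)) (tri22 (d2 (Trian 0 0 b)))"
  "d3 (Trian a m b) = Trian (tri11 (d3 (Trian a 0 0)))
     ((a \<rhd> tri12 (d3 (Trian 1 0 0))) + tri12 (d3 (Trian 0 m 0))
       - (tri12 (d2 (Trian 1 0 0)) \<lhd> b)) (tri22 (d3 (Trian 0 0 b)))"
  \<comment> \<open>The equations are instantiated because the general ones rewrite a value at \<open>1\<close> to a
    multiple of itself forever.\<close>
  using additive_trian_corner_sum[OF hom(1), of a m b]
    additive_trian_corner_sum[OF hom(2), of a m b] additive_trian_corner_sum[OF hom(3), of a m b]
  by (simp_all add: plus_trian_def ternary_derivation_trian_diagonal
      ternary_derivation_trian_off_diagonal(1,2,5)[where a = a]
      ternary_derivation_trian_off_diagonal(3,4,6)[where b = b])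

end

section \<open>Maps in block form\<close>

text \<open>In the upper right entry of \<open>d2 x y + x d3 y\<close> the element \<open>n2\<close> contributes
  \<open>(a \<rhd> n2) \<lhd> b' - a \<rhd> (n2 \<lhd> b')\<close>, where \<open>a\<close> is the upper left entry of \<open>x\<close> and \<open>b'\<close>
  the lower right entry of \<open>y\<close>. This vanishes because the two actions commute, and so agrees
  with \<open>d1 (x y)\<close>, where \<open>n2\<close> does not occur.\<close>
lemma (in algebra_bimodule) ternary_derivation_of_block_form:
  assumes hom: "module_hom scaleT scaleT d1" "module_hom scaleT scaleT d2"
      "module_hom scaleT scaleT d3"
    and d1: "\<forall>a m b. d1 (Trian a m b) = Trian (\<delta>1 a) ((a \<rhd> n1) + \<tau>1 m + (n1' \<lhd> b)) (\<mu>1 b)"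
    and d2: "\<forall>a m b. d2 (Trian a m b) = Trian (\<delta>2 a) ((a \<rhd> n2) + \<tau>2 m + (n1' \<lhd> b)) (\<mu>2 b)"
    and d3: "\<forall>a m b. d3 (Trian a m b) = Trian (\<delta>3 a) ((a \<rhd> n1) + \<tau>3 m - (n2 \<lhd> b)) (\<mu>3 b)"
    and \<tau>1: "module_hom scaleM scaleM \<tau>1"
    and \<delta>: "ternary_derivation scaleA (*) \<delta>1 \<delta>2 \<delta>3"
    and \<mu>: "ternary_derivation scaleB (*) \<mu>1 \<mu>2 \<mu>3"
    and left: "\<forall>a m. \<tau>1 (a \<rhd> m) = (\<delta>2 a \<rhd> m) + (a \<rhd> \<tau>3 m)"
    and right: "\<forall>b m. \<tau>1 (m \<lhd> b) = (m \<lhd> \<mu>3 b) + (\<tau>2 m \<lhd> b)"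
  shows "ternary_derivation scaleT multT d1 d2 d3"
proof -
  have "d1 (multT x y) = multT (d2 x) y + multT x (d3 y)" for x y
    using \<delta> \<mu>
    by (cases x; cases y)
      (simp add: d1 d2 d3 trian_mult_def plus_trian_def ternary_derivation_def left right
        module_hom.add[OF \<tau>1] lact_add_right lact_diff_right ract_add_left lact_mult ract_mult
        lact_ract)
  with hom show ?thesis
    by (simp add: ternary_derivation_def)
qed

theorem theorem4p1:
  fixes scaleA :: "'r::comm_ring_1 \<Rightarrow> 'a::ring_1 \<Rightarrow> 'a"
    and scaleB :: "'r \<Rightarrow> 'b::ring_1 \<Rightarrow> 'b"
    and scaleM :: "'r \<Rightarrow> 'm::ab_group_add \<Rightarrow> 'm"
    and lact :: "'a \<Rightarrow> 'm \<Rightarrow> 'm" (infixr "\<rhd>" 75)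
    and ract :: "'m \<Rightarrow> 'b \<Rightarrow> 'm" (infixl "\<lhd>" 75)
    and d1 d2 d3 :: "('a, 'm, 'b) trian \<Rightarrow> ('a, 'm, 'b) trian"
  defines "scaleT \<equiv> trian_scale scaleA scaleM scaleB"
  assumes "algebra_bimodule scaleA scaleB scaleM lact ract"
    and "\<exists>m::'m. m \<noteq> 0"
    and "module_hom scaleT scaleT d1"
    and "module_hom scaleT scaleT d2"
    and "module_hom scaleT scaleT d3"
  shows "ternary_derivation scaleT (trian_mult lact ract) d1 d2 d3 \<longleftrightarrow>
    (\<exists>(n1::'m) (n1'::'m) (n2::'m)
       (\<delta>1::'a \<Rightarrow> 'a) (\<delta>2::'a \<Rightarrow> 'a) (\<delta>3::'a \<Rightarrow> 'a)
       (\<tau>1::'m \<Rightarrow> 'm) (\<tau>2::'m \<Rightarrow> 'm) (\<tau>3::'m \<Rightarrow> 'm)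
       (\<mu>1::'b \<Rightarrow> 'b) (\<mu>2::'b \<Rightarrow> 'b) (\<mu>3::'b \<Rightarrow> 'b).
       module_hom scaleA scaleA \<delta>1 \<and> module_hom scaleA scaleA \<delta>2 \<and> module_hom scaleA scaleA \<delta>3 \<and>
       module_hom scaleM scaleM \<tau>1 \<and> module_hom scaleM scaleM \<tau>2 \<and> module_hom scaleM scaleM \<tau>3 \<and>
       module_hom scaleB scaleB \<mu>1 \<and> module_hom scaleB scaleB \<mu>2 \<and> module_hom scaleB scaleB \<mu>3 \<and>
       (\<forall>a m b. d1 (Trian a m b) =
          Trian (\<delta>1 a) ((a \<rhd> n1) + \<tau>1 m + (n1' \<lhd> b)) (\<mu>1 b)) \<and>
       (\<forall>a m b. d2 (Trian a m b) =
          Trian (\<delta>2 a) ((a \<rhd> n2) + \<tau>2 m + (n1' \<lhd> b)) (\<mu>2 b)) \<and>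
       (\<forall>a m b. d3 (Trian a m b) =
          Trian (\<delta>3 a) ((a \<rhd> n1) + \<tau>3 m - (n2 \<lhd> b)) (\<mu>3 b)) \<and>
       ternary_derivation scaleA (*) \<delta>1 \<delta>2 \<delta>3 \<and>
       ternary_derivation scaleB (*) \<mu>1 \<mu>2 \<mu>3 \<and>
       (\<forall>a m. \<tau>1 (a \<rhd> m) = (\<delta>2 a \<rhd> m) + (a \<rhd> \<tau>3 m)) \<and>
       (\<forall>b m. \<tau>1 (m \<lhd> b) = (m \<lhd> \<mu>3 b) + (\<tau>2 m \<lhd> b)))"
  (is "_ \<longleftrightarrow> ?block_form")
proof
  interpret algebra_bimodule scaleA scaleB scaleM lact ract
    by fact
  {
    assume "ternary_derivation scaleT (trian_mult lact ract) d1 d2 d3"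
    then interpret trian_ternary_derivation scaleA scaleB scaleM lact ract d1 d2 d3
      by unfold_locales (simp add: scaleT_def)
    note blocks = hom[THEN module_hom_diagonal_blocks(1)] hom[THEN module_hom_diagonal_blocks(2)]
      hom[THEN module_hom_diagonal_blocks(3)]
    show ?block_form
      by (intro exI conjI allI; (rule blocks block_form blocks_ternary_A blocks_ternary_B blocks_action))
  next
    assume ?block_form
    then show "ternary_derivation scaleT (trian_mult lact ract) d1 d2 d3"
      using assms(4-6) unfolding scaleT_def
      by (elim exE conjE) (rule ternary_derivation_of_block_form)
  }
qed

end
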